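(* Let $(V,d)$ be a separable, locally convex metric vector space over $\mathbb{R}$, let $\mathfrak{M}\subseteq\mathbb{N}$ be an infinite set of natural numbers, and let $A\subset V$ be a subset such that $\overline{\operatorname{conv}A}=V$. Let $T:V^{\mathbb{N}}\to V^{\mathbb{N}}$ be the Cesaro operator. Let $\Theta(A,\mathfrak{M})$ be the set of all $\vartheta=(\vartheta_n)\in A^{\mathbb{N}}$ such that for each sequence of "targets" $(x_k)\in V^{\mathbb{N}}$ there exists a sequence of indices $\lambda_n$, $n=1,2,\ldots$, such that $\lambda_n\in\mathfrak{M}$ and $$\lim_{n\to\infty}[T^k(\vartheta)]_{\lambda_n}=x_k\quad\text{for all } k=1,2,\ldots$$ Then $\Theta(A,\mathfrak{M})$ is dense and $G_\delta$ in $A^{\mathbb{N}}$. Moreover, if $A$ is a vector space, then $\Theta(A,\mathfrak{M})$ contains a linear subspace of $V^{\mathbb{N}}$ with the exception of $0$.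
   Context: $\mathbb{N}=\{1,2,\ldots\}$. The topology of $V$ is given by a countable separating family of seminorms $\|\cdot\|_i$, $i=1,2,\ldots$, and is generated by the metric $d(x,y)=\sum_{i=1}^\infty \frac{1}{2^i}\frac{\|x-y\|_i}{1+\|x-y\|_i}$. The Cesaro operator $T:V^{\mathbb{N}}\to V^{\mathbb{N}}$ is defined by $[T(a)]_n=\frac{a_1+\cdots+a_n}{n}$ for $a=(a_n)\in V^{\mathbb{N}}$, where $[b]_n$ denotes the $n$-th term of a sequence $b$; $T^1=T$ and $T^k=T\circ T^{k-1}$ for $k\ge 2$. $\operatorname{conv}A$ is the convex hull of $A$, and the bar denotes closure in $V$. $A^{\mathbb{N}}$ carries the product topology. "Contains a linear subspace with the exception of $0$" means that all nonzero elements of the subspace belong to the set. *)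

theory Defs
  imports "HOL-Analysis.Analysis" "HOL-Library.Function_Algebras"
begin

definition seminorm :: "('v::real_vector \<Rightarrow> real) \<Rightarrow> bool" where
  "seminorm p \<longleftrightarrow>
     (\<forall>x. 0 \<le> p x) \<and> (\<forall>x y. p (x + y) \<le> p x + p y) \<and> (\<forall>c x. p (c *\<^sub>R x) = \<bar>c\<bar> * p x)"

definition separating :: "(nat \<Rightarrow> 'v::real_vector \<Rightarrow> real) \<Rightarrow> bool" where
  "separating p \<longleftrightarrow> (\<forall>x. (\<forall>i. p i x = 0) \<longrightarrow> x = 0)"

(* The i-th seminorm, i = 1, 2, ..., is p (i - 1); this shift gives the weight 1 / 2 ^ Suc i. *)
definition seminorm_metric :: "(nat \<Rightarrow> 'v::real_vector \<Rightarrow> real) \<Rightarrow> 'v \<Rightarrow> 'v \<Rightarrow> real" where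
  "seminorm_metric p x y = (\<Sum>i. 1 / 2 ^ Suc i * (p i (x - y) / (1 + p i (x - y))))"

(* The topology of the class metric_space is the one induced by dist. *)
definition lc_metric_space :: "(nat \<Rightarrow> 'v::{real_vector, metric_space} \<Rightarrow> real) \<Rightarrow> bool" where
  "lc_metric_space p \<longleftrightarrow>
     (\<forall>i. seminorm (p i)) \<and> separating p \<and> (\<forall>x y. dist x y = seminorm_metric p x y)"

(* A sequence (a_1, a_2, ...) is represented by the function on nat whose value at 0 is a_1;
   seq_term b n is its n-th term for n \<ge> 1.  (A function indexed from 1 would carry a spurious
   extra coordinate at 0 in the sequence space.) *)
definition seq_term :: "(nat \<Rightarrow> 'v) \<Rightarrow> nat \<Rightarrow> 'v" where
  "seq_term b n = b (n - 1)"

definition cesaro :: "(nat \<Rightarrow> 'v::real_vector) \<Rightarrow> nat \<Rightarrow> 'v" where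
  "cesaro a = (\<lambda>m. (1 / real (Suc m)) *\<^sub>R (\<Sum>j = 1..Suc m. seq_term a j))"

lemma seq_term_cesaro:
  assumes "n \<ge> 1"
  shows "seq_term (cesaro a) n = (1 / real n) *\<^sub>R (\<Sum>j = 1..n. seq_term a j)"
proof -
  from assms obtain m where "n = Suc m"
    by (cases n) auto
  moreover have "seq_term (cesaro a) (Suc m) = cesaro a m"
    by (simp add: seq_term_def)
  ultimately show ?thesis
    by (simp only: cesaro_def)
qed

definition seq_topology :: "'v::topological_space set \<Rightarrow> (nat \<Rightarrow> 'v) topology" where
  "seq_topology A = product_topology (\<lambda>_. top_of_set A) UNIV"

definition Theta :: "'v::{real_vector, topological_space} set \<Rightarrow> nat set \<Rightarrow> (nat \<Rightarrow> 'v) set" where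
  "Theta A M =
     {\<theta> \<in> UNIV \<rightarrow> A. \<forall>x :: nat \<Rightarrow> 'v. \<exists>l :: nat \<Rightarrow> nat. (\<forall>n. l n \<in> M) \<and>
        (\<forall>k\<ge>1. (\<lambda>n. seq_term ((cesaro ^^ k) \<theta>) (l n)) \<longlonglongrightarrow> seq_term x k)}"

definition seq_scale :: "real \<Rightarrow> (nat \<Rightarrow> 'v::real_vector) \<Rightarrow> nat \<Rightarrow> 'v" where
  "seq_scale c a = (\<lambda>n. c *\<^sub>R a n)"

lemma vector_space_seq_scale:
  "vector_space (seq_scale :: real \<Rightarrow> (nat \<Rightarrow> 'v::real_vector) \<Rightarrow> nat \<Rightarrow> 'v)"
  by unfold_locales (auto simp: seq_scale_def fun_eq_iff algebra_simps)

(* The subspace W = {0} would satisfy the inclusion vacuously, so W is required to be nonzero;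
   for V = {0} the sequence space itself is zero and no such W exists. *)
definition contains_subspace_except_0 :: "(nat \<Rightarrow> 'v::real_vector) set \<Rightarrow> bool" where
  "contains_subspace_except_0 S \<longleftrightarrow>
     (\<exists>W. module.subspace seq_scale W \<and> W - {0} \<subseteq> S \<and> ((UNIV :: 'v set) \<noteq> {0} \<longrightarrow> W \<noteq> {0}))"

end

theory Submission
  imports Defs
begin

text \<open>
  A point of the sequence space lies in Theta iff its Cesaro iterates, read at the indices in M, come
  close to each of countably many finite lists of targets; each of these conditions is open, which gives
  the G-delta property. V is not assumed complete, so density is not obtained from Baire's theorem
  but by extending prefixes: each condition depends on a finite prefix only, and every prefix over A
  extends to one that forces any given condition.

  For this extension step, index sequences from 0. The sequence j choose r is an eigenvector of the
  Cesaro operator with eigenvalue 1 / (r + 1), so a Vandermonde system yields vectors c r such that the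
  iterates of f j = (\<Sum>r<K. (j choose r) / (m choose r) *R c r) take the prescribed values at
  index m. As the scalar coefficients lie in [0, 1], all values of f are, up to a small error, convex
  combinations of one finite subset of A that does not depend on m. A greedy choice from that finite
  set follows f with bounded discrepancy in the partial sums, and bounded partial sums
  are killed by the Cesaro iterates as m grows.

  If A is a subspace, the line spanned by a single element of Theta has the required property.
\<close>

section \<open>Vandermonde systems with vector unknowns\<close>

text \<open>Elimination suits vector unknowns: subtracting \<open>z K\<close> times row
  \<open>k\<close> from row \<open>k + 1\<close> removes the last unknown and leaves a system of
  size \<open>K\<close> for the vectors \<open>c r\<close> scaled by \<open>z r - z K\<close>, to
  which induction applies.\<close>

lemma vandermonde_solvable:
  fixes z :: "nat \<Rightarrow> real" and x :: "nat \<Rightarrow> 'v::real_vector"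
  assumes "inj_on z {..<K}"
  shows "\<exists>c. \<forall>k<K. (\<Sum>r<K. z r ^ k *\<^sub>R c r) = x k"
  using assms
proof (induction K arbitrary: x)
  case 0
  then show ?case by simp
next
  case (Suc K)
  have inj: "inj_on z {..<K}"
    using Suc.prems by (rule inj_on_subset) auto
  obtain c' where c': "\<And>k. k < K \<Longrightarrow> (\<Sum>r<K. z r ^ k *\<^sub>R c' r) = x (Suc k) - z K *\<^sub>R x k"
    using Suc.IH[OF inj, of "\<lambda>k. x (Suc k) - z K *\<^sub>R x k"] by blast
  have neq: "z r - z K \<noteq> 0" if "r < K" for r
    using Suc.prems that by (auto dest: inj_onD)
  define d where "d r = (1 / (z r - z K)) *\<^sub>R c' r" for r
  define c where "c = d(K := x 0 - (\<Sum>r<K. d r))"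
  have c'_eq: "c' r = (z r - z K) *\<^sub>R d r" if "r < K" for r
    using neq[OF that] by (simp add: d_def)
  have split: "(\<Sum>r<Suc K. z r ^ k *\<^sub>R c r) = (\<Sum>r<K. z r ^ k *\<^sub>R d r) + z K ^ k *\<^sub>R c K" for k
    by (auto simp: c_def intro!: sum.cong)
  \<comment> \<open>Row 0 holds by the choice of \<open>c K\<close>; each later row follows from its
    predecessor, since the reduced system fixes their difference.\<close>
  have "(\<Sum>r<Suc K. z r ^ k *\<^sub>R c r) = x k" if "k < Suc K" for k
    using that
  proof (induction k)
    case 0
    show ?case unfolding split by (simp add: c_def)
  next
    case (Suc k)
    have "x (Suc k) - z K *\<^sub>R x k = (\<Sum>r<K. z r ^ k *\<^sub>R ((z r - z K) *\<^sub>R d r))"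
      using c'[of k] Suc.prems c'_eq by simp
    also have "\<dots> = (\<Sum>r<K. z r ^ Suc k *\<^sub>R d r) - z K *\<^sub>R (\<Sum>r<K. z r ^ k *\<^sub>R d r)"
      by (simp add: scaleR_sum_right algebra_simps flip: sum_subtractf)
    also have "\<dots> = (\<Sum>r<Suc K. z r ^ Suc k *\<^sub>R c r) - z K *\<^sub>R (\<Sum>r<Suc K. z r ^ k *\<^sub>R c r)"
      unfolding split by (simp add: scaleR_add_right)
    finally show ?case using Suc by simp
  qed
  then show ?case by blast
qed

section \<open>Cesaro iterates: linearity, locality, eigenvectors\<close>

lemma cesaro_eq: "cesaro a n = (1 / real (Suc n)) *\<^sub>R (\<Sum>j\<le>n. a j)"
proof -
  have "(\<Sum>j = 1..Suc n. seq_term a j) = (\<Sum>j\<le>n. a j)"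
    unfolding seq_term_def by (rule sum.reindex_bij_witness[of _ Suc "\<lambda>j. j - 1"]) auto
  then show ?thesis
    by (simp only: cesaro_def)
qed

lemma cesaro_funpow_Suc:
  "(cesaro ^^ Suc k) a n = (1 / real (Suc n)) *\<^sub>R (\<Sum>j\<le>n. (cesaro ^^ k) a j)"
  by (simp only: funpow.simps o_apply cesaro_eq[of "(cesaro ^^ k) a"])

lemma cesaro_diff: "cesaro (\<lambda>n. a n - b n) = (\<lambda>n. cesaro a n - cesaro b n)"
  by (simp add: fun_eq_iff cesaro_eq sum_subtractf scaleR_diff_right)

lemma cesaro_scaleR: "cesaro (\<lambda>n. c *\<^sub>R a n) = (\<lambda>n. c *\<^sub>R cesaro a n)"
  by (simp add: fun_eq_iff cesaro_eq scaleR_sum_right mult.commute)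

lemma cesaro_funpow_diff:
  "(cesaro ^^ k) (\<lambda>n. a n - b n) = (\<lambda>n. (cesaro ^^ k) a n - (cesaro ^^ k) b n)"
  by (induction k) (simp_all add: cesaro_diff)

lemma cesaro_funpow_scaleR: "(cesaro ^^ k) (\<lambda>n. c *\<^sub>R a n) = (\<lambda>n. c *\<^sub>R (cesaro ^^ k) a n)"
  by (induction k) (simp_all add: cesaro_scaleR)

text \<open>A mean at \<open>n\<close> reads only positions up to \<open>n\<close>, hence so does
  every iterate. A condition at one index thus concerns a finite prefix.\<close>

lemma cesaro_funpow_cong:
  assumes "\<And>j. j \<le> n \<Longrightarrow> a j = b j"
  shows "(cesaro ^^ k) a n = (cesaro ^^ k) b n"
  using assms
proof (induction k arbitrary: n)
  case (Suc k)
  have "(cesaro ^^ k) a j = (cesaro ^^ k) b j" if "j \<le> n" for j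
    using Suc.IH[of j] Suc.prems that by simp
  then show ?case
    by (simp only: cesaro_funpow_Suc) simp
qed simp

text \<open>The hockey-stick identity turns the partial sums of \<open>j choose r\<close> into
  \<open>Suc n choose Suc r\<close>, and absorption turns this into a multiple of
  \<open>n choose r\<close>; linearity does the rest.\<close>

lemma cesaro_funpow_binomial:
  "(cesaro ^^ k) (\<lambda>j. \<Sum>r<K. real (j choose r) *\<^sub>R c r) n =
     (\<Sum>r<K. (1 / real (Suc r)) ^ k *\<^sub>R (real (n choose r) *\<^sub>R c r))"
proof (induction k arbitrary: n)
  case (Suc k)
  have *: "(1 / real (Suc n)) * (\<Sum>j\<le>n. real (j choose r)) = (1 / real (Suc r)) * real (n choose r)" for r
  proof -
    have "real (Suc r) * real (Suc n choose Suc r) = real (Suc n) * real (n choose r)"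
      by (metis Suc_times_binomial_eq of_nat_mult mult.commute)
    moreover have "(\<Sum>j\<le>n. real (j choose r)) = real (Suc n choose Suc r)"
      by (simp only: sum_choose_upper flip: of_nat_sum)
    ultimately show ?thesis
      by (simp add: field_simps del: binomial_Suc_Suc)
  qed
  have "(cesaro ^^ Suc k) (\<lambda>j. \<Sum>r<K. real (j choose r) *\<^sub>R c r) n
      = (1 / real (Suc n)) *\<^sub>R (\<Sum>j\<le>n. \<Sum>r<K. (1 / real (Suc r)) ^ k *\<^sub>R (real (j choose r) *\<^sub>R c r))"
    by (simp only: cesaro_funpow_Suc Suc.IH)
  also have "\<dots> = (\<Sum>r<K. ((1 / real (Suc r)) ^ k * ((1 / real (Suc n)) * (\<Sum>j\<le>n. real (j choose r)))) *\<^sub>R c r)"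
    by (subst sum.swap)
       (simp add: scaleR_sum_right sum_distrib_left scaleR_sum_left mult.commute mult.left_commute del: of_nat_Suc)
  also have "\<dots> = (\<Sum>r<K. (1 / real (Suc r)) ^ Suc k *\<^sub>R (real (n choose r) *\<^sub>R c r))"
    unfolding * by (simp add: mult.commute mult.left_commute)
  finally show ?case .
qed simp

section \<open>Seminorms and the decay of iterated means\<close>

lemma
  assumes "seminorm q"
  shows seminorm_ge_0: "0 \<le> q x"
    and seminorm_add: "q (x + y) \<le> q x + q y"
    and seminorm_scaleR: "q (c *\<^sub>R x) = \<bar>c\<bar> * q x"
  using assms unfolding seminorm_def by blast+

lemma
  assumes "seminorm q"
  shows seminorm_0: "q 0 = 0"
    and seminorm_minus: "q (- x) = q x"
  using seminorm_scaleR[OF assms, of 0 0] seminorm_scaleR[OF assms, of "- 1" x] by simp_all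

lemma seminorm_diff: "seminorm q \<Longrightarrow> q (x - y) \<le> q x + q y"
  using seminorm_add[of q x "- y"] by (simp add: seminorm_minus)

lemma seminorm_sum:
  assumes "seminorm q"
  shows "q (\<Sum>i\<in>I. f i) \<le> (\<Sum>i\<in>I. q (f i))"
proof (induction I rule: infinite_finite_induct)
  case (insert i I)
  then show ?case using seminorm_add[OF assms, of "f i" "sum f I"] by simp
qed (simp_all add: seminorm_0[OF assms])

text \<open>The bound telescopes: by the inequality of means, the increment \<open>t - s\<close> of
  the square root is at least \<open>1 / (2 * t)\<close>.\<close>

lemma sum_inverse_sqrt_le: "(\<Sum>j\<le>n. 1 / sqrt (real (Suc j))) \<le> 2 * sqrt (real (Suc n))"
proof (induction n)
  case (Suc n)
  define s t where "s = sqrt (real (Suc n))" and "t = sqrt (real (Suc (Suc n)))"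
  have "s\<^sup>2 + 1 = t\<^sup>2" "0 < t"
    by (simp_all add: s_def t_def)
  moreover have "2 * (s * t) \<le> s\<^sup>2 + t\<^sup>2"
    using sum_squares_bound[of s t] by simp
  ultimately have "2 * s + 1 / t \<le> 2 * t"
    by (simp add: field_simps power2_eq_square)
  with Suc show ?case
    by (simp add: s_def t_def)
qed simp

text \<open>Averaging reproduces the rate \<open>1 / sqrt n\<close> up to a factor 2, whereas
  \<open>1 / n\<close> would pick up a logarithm each time. The constant part \<delta> is
  preserved.\<close>

lemma seminorm_cesaro_le:
  assumes q: "seminorm q" and "0 \<le> C" and le: "\<And>n. q (e n) \<le> \<delta> + C / sqrt (real (Suc n))"
  shows "q (cesaro e n) \<le> \<delta> + 2 * C / sqrt (real (Suc n))"
proof -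
  have "q (cesaro e n) \<le> (1 / real (Suc n)) * (\<Sum>j\<le>n. q (e j))"
    unfolding cesaro_eq seminorm_scaleR[OF q]
    using seminorm_sum[OF q, of e "{..n}"] by (simp add: divide_right_mono)
  also have "\<dots> \<le> (1 / real (Suc n)) * (\<Sum>j\<le>n. \<delta> + C * (1 / sqrt (real (Suc j))))"
    by (intro mult_left_mono sum_mono) (use le in auto)
  also have "\<dots> = \<delta> + C * ((1 / real (Suc n)) * (\<Sum>j\<le>n. 1 / sqrt (real (Suc j))))"
    unfolding sum.distrib sum_distrib_left[symmetric] by (simp add: distrib_left del: of_nat_Suc)
  also have "\<dots> \<le> \<delta> + C * ((1 / real (Suc n)) * (2 * sqrt (real (Suc n))))"
    by (intro add_left_mono mult_left_mono sum_inverse_sqrt_le) (use assms in auto)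
  also have "\<dots> = \<delta> + 2 * C / sqrt (real (Suc n))"
  proof -
    have "sqrt (real (Suc n)) / real (Suc n) = 1 / sqrt (real (Suc n))"
      using real_div_sqrt[of "real (Suc n)"] by (simp add: divide_simps)
    then show ?thesis
      by (metis mult.assoc mult.commute mult.left_commute times_divide_eq_left times_divide_eq_right mult_1)
  qed
  finally show ?thesis .
qed

lemma seminorm_cesaro_funpow_le:
  assumes q: "seminorm q" and C: "0 \<le> C" and le: "\<And>n. q (e n) \<le> \<delta> + C / sqrt (real (Suc n))"
  shows "q ((cesaro ^^ k) e n) \<le> \<delta> + 2 ^ k * C / sqrt (real (Suc n))"
proof (induction k arbitrary: n)
  case 0
  show ?case using le by simp
next
  case (Suc k)
  show ?case
    using seminorm_cesaro_le[OF q _ Suc.IH, of n] C by (simp add: mult_ac)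
qed

section \<open>Rounding convex combinations with bounded discrepancy\<close>

lemma bounded_discrepancy_sequence:
  fixes \<nu> :: "nat \<Rightarrow> 'a \<Rightarrow> real"
  assumes F: "finite F" "F \<noteq> {}"
    and \<nu>0: "\<And>j b. b \<in> F \<Longrightarrow> 0 \<le> \<nu> j b" and \<nu>1: "\<And>j. (\<Sum>b\<in>F. \<nu> j b) = 1"
  shows "\<exists>a. (\<forall>j. a j \<in> F) \<and>
    (\<forall>n. \<forall>b\<in>F. \<bar>\<Sum>j<n. \<nu> j b - of_bool (a j = b)\<bar> \<le> real (card F))"
proof -
  \<comment> \<open>Always pick the element that is furthest behind its quota: then no deficit drops below -1,
      and since the deficits add up to 0 none exceeds card F - 1.\<close>
  define P :: "nat \<Rightarrow> ('a \<Rightarrow> real) \<Rightarrow> bool" where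
    "P n D \<longleftrightarrow> (n = 0 \<longrightarrow> D = (\<lambda>_. 0)) \<and> (\<forall>b\<in>F. - 1 \<le> D b) \<and> sum D F = 0" for n D
  have "\<exists>D'. P (Suc n) D' \<and> (\<exists>a\<in>F. D' = (\<lambda>b. D b + \<nu> n b - of_bool (a = b)))" if "P n D" for n D
  proof -
    define E where "E b = D b + \<nu> n b" for b
    have "Max (E ` F) \<in> E ` F"
      using F by (intro Max_in) auto
    then obtain a where a: "a \<in> F" and "Max (E ` F) = E a"
      by blast
    then have Ea: "E b \<le> E a" if "b \<in> F" for b
      using F Max_ge[of "E ` F" "E b"] that by simp
    \<comment> \<open>The deficits sum to 0 and one unit of quota is added, so the largest entry of
      \<open>E\<close> is nonnegative and can give up 1.\<close>
    have sumE: "sum E F = 1"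
      using that \<nu>1[of n] by (simp add: E_def sum.distrib P_def)
    have "0 \<le> E a"
    proof (rule ccontr)
      assume "\<not> 0 \<le> E a"
      then have "sum E F \<le> 0"
        using Ea by (intro sum_nonpos) (meson le_less_trans not_le less_imp_le)
      with sumE show False by simp
    qed
    moreover have "- 1 \<le> E b" if "b \<in> F" for b
      using \<open>P n D\<close> \<nu>0[OF that, of n] that unfolding P_def E_def
      by (metis add_increasing2)
    moreover have "(\<Sum>b\<in>F. E b - of_bool (a = b)) = 0"
      using sumE F a by (simp add: sum_subtractf of_bool_def)
    ultimately have "P (Suc n) (\<lambda>b. E b - of_bool (a = b))"
      unfolding P_def by (simp add: of_bool_def)
    with a show ?thesis
      unfolding E_def by blast
  qed
  \<comment> \<open>Dependent choice returns only some sequence satisfying \<open>P\<close>; the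
    clause for \<open>n = 0\<close> makes its initial deficits 0.\<close>
  then have "\<exists>D. \<forall>n. P n (D n) \<and> (\<exists>a\<in>F. D (Suc n) = (\<lambda>b. D n b + \<nu> n b - of_bool (a = b)))"
    by (intro dependent_nat_choice[of P "\<lambda>n D D'. \<exists>a\<in>F. D' = (\<lambda>b. D b + \<nu> n b - of_bool (a = b))"])
      (auto simp: P_def[of 0])
  then obtain D where PD: "\<And>n. P n (D n)"
    and step: "\<forall>n. \<exists>a\<in>F. D (Suc n) = (\<lambda>b. D n b + \<nu> n b - of_bool (a = b))"
    by blast
  from step have "\<exists>a. \<forall>n. a n \<in> F \<and> D (Suc n) = (\<lambda>b. D n b + \<nu> n b - of_bool (a n = b))"
    by (intro choice) blast
  then obtain a where a: "\<And>n. a n \<in> F"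
    "\<And>n. D (Suc n) = (\<lambda>b. D n b + \<nu> n b - of_bool (a n = b))"
    by blast
  have D_eq: "D n b = (\<Sum>j<n. \<nu> j b - of_bool (a j = b))" for n b
    using PD[of 0] by (induction n) (simp_all add: a(2) P_def)
  have "\<bar>D n b\<bar> \<le> real (card F)" if b: "b \<in> F" for n b
  proof -
    have ge: "- 1 \<le> D n b'" if "b' \<in> F" for b'
      using PD[of n] that by (simp add: P_def)
    have "D n b = - (\<Sum>b'\<in>F - {b}. D n b')"
      using PD[of n] F b by (simp add: P_def sum.remove[of F b])
    also have "\<dots> \<le> real (card (F - {b}))"
      using sum_mono[of "F - {b}" "\<lambda>_. - 1" "D n"] ge by simp
    also have "\<dots> \<le> real (card F)"
      using F card_mono[of F "F - {b}"] by auto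
    finally have "D n b \<le> real (card F)" .
    moreover have "1 \<le> real (card F)"
      using F by (simp add: Suc_le_eq card_gt_0_iff)
    ultimately show ?thesis
      using ge[OF b] by linarith
  qed
  then show ?thesis
    using a(1) D_eq by auto
qed

text \<open>All \<open>y r\<close> are convex combinations of one finite \<open>F\<close> inside
  \<open>A\<close>, so mixing them by \<open>s j\<close> gives weights on \<open>F\<close> that the
  greedy sequence follows. The bound \<open>C\<close> depends on \<open>F\<close> and
  \<open>q\<close> but not on \<open>s\<close>, hence the order of the quantifiers.\<close>

lemma convex_hull_rounding:
  assumes q: "seminorm q" and I: "finite I" and y: "\<And>r. r \<in> I \<Longrightarrow> y r \<in> convex hull A"
  shows "\<exists>C\<ge>0. \<forall>s :: nat \<Rightarrow> 'i \<Rightarrow> real.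
      (\<forall>j. (\<forall>r\<in>I. 0 \<le> s j r) \<and> (\<Sum>r\<in>I. s j r) = 1) \<longrightarrow>
      (\<exists>a. (\<forall>j. a j \<in> A \<and> q (a j) \<le> C) \<and>
        (\<forall>n. q (\<Sum>j<n. a j - (\<Sum>r\<in>I. s j r *\<^sub>R y r)) \<le> C))"
proof -
  have "\<forall>r\<in>I. \<exists>S u. finite S \<and> S \<subseteq> A \<and> (\<forall>v\<in>S. 0 \<le> u v) \<and> sum u S = 1 \<and> (\<Sum>v\<in>S. u v *\<^sub>R v) = y r"
    using y unfolding convex_hull_explicit by blast
  then have "\<exists>S u. \<forall>r\<in>I. finite (S r) \<and> S r \<subseteq> A \<and> (\<forall>v\<in>S r. 0 \<le> u r v) \<and> sum (u r) (S r) = 1 \<and>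
      (\<Sum>v\<in>S r. u r v *\<^sub>R v) = y r"
    by (fast dest!: bchoice)
  then obtain S u where S: "\<And>r. r \<in> I \<Longrightarrow> finite (S r)" "\<And>r. r \<in> I \<Longrightarrow> S r \<subseteq> A"
    and u: "\<And>r v. \<lbrakk>r \<in> I; v \<in> S r\<rbrakk> \<Longrightarrow> 0 \<le> u r v" "\<And>r. r \<in> I \<Longrightarrow> sum (u r) (S r) = 1"
      "\<And>r. r \<in> I \<Longrightarrow> (\<Sum>v\<in>S r. u r v *\<^sub>R v) = y r"
    by blast
  define F where "F = (\<Union>r\<in>I. S r)"
  define w where "w r v = (if v \<in> S r then u r v else 0)" for r v
  have F: "finite F" "F \<subseteq> A"
    using S I by (auto simp: F_def)
  have w0: "0 \<le> w r v" if "r \<in> I" for r v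
    using u(1) that by (simp add: w_def)
  have FS: "F \<inter> S r = S r" if "r \<in> I" for r
    using that by (auto simp: F_def)
  have w1: "sum (w r) F = 1" if "r \<in> I" for r
    using u(2)[OF that] F FS[OF that] by (simp add: w_def sum.If_cases)
  have wy: "(\<Sum>v\<in>F. w r v *\<^sub>R v) = y r" if "r \<in> I" for r
    using u(3)[OF that] F FS[OF that] by (simp add: w_def if_distrib[of "\<lambda>c. c *\<^sub>R _"] sum.If_cases cong: if_cong)
  define Q where "Q = (\<Sum>v\<in>F. q v)"
  have q0: "0 \<le> q v" for v
    using seminorm_ge_0[OF q] .
  have Q0: "0 \<le> Q"
    unfolding Q_def by (intro sum_nonneg q0)
  \<comment> \<open>The summand \<open>card F * Q\<close> accounts for the partial sums, the summand
    \<open>Q\<close> for the single values.\<close>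
  show ?thesis
  proof (intro exI[of _ "Q + real (card F) * Q"] conjI allI impI)
    show "0 \<le> Q + real (card F) * Q"
      using Q0 by simp
    fix s :: "nat \<Rightarrow> 'i \<Rightarrow> real"
    assume "\<forall>j. (\<forall>r\<in>I. 0 \<le> s j r) \<and> (\<Sum>r\<in>I. s j r) = 1"
    then have s0: "\<And>j r. r \<in> I \<Longrightarrow> 0 \<le> s j r" and s1: "\<And>j. (\<Sum>r\<in>I. s j r) = 1"
      by blast+
    have "I \<noteq> {}"
      using s1[of 0] by auto
    then have "F \<noteq> {}"
      using w1 by fastforce
    define \<nu> where "\<nu> j v = (\<Sum>r\<in>I. s j r * w r v)" for j v
    have "(\<Sum>v\<in>F. \<nu> j v) = 1" for j
      unfolding \<nu>_def by (subst sum.swap) (simp add: w1 s1 flip: sum_distrib_left)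
    moreover have "0 \<le> \<nu> j v" for j v
      unfolding \<nu>_def by (intro sum_nonneg mult_nonneg_nonneg s0 w0)
    ultimately obtain a where a: "\<And>j. a j \<in> F"
      and disc: "\<And>n v. v \<in> F \<Longrightarrow> \<bar>\<Sum>j<n. \<nu> j v - of_bool (a j = v)\<bar> \<le> real (card F)"
      using bounded_discrepancy_sequence[OF F(1) \<open>F \<noteq> {}\<close>, of \<nu>] by blast
    \<comment> \<open>With \<open>a j\<close> written as a point mass, both sums are combinations
      over \<open>F\<close>, and their difference has the controlled deficits as coefficients, up to
      sign.\<close>
    have av: "a j = (\<Sum>v\<in>F. of_bool (a j = v) *\<^sub>R v)" for j
      using F a[of j] by (simp add: of_bool_def if_distrib[of "\<lambda>c. c *\<^sub>R _"] cong: if_cong)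
    have \<nu>y: "(\<Sum>r\<in>I. s j r *\<^sub>R y r) = (\<Sum>v\<in>F. \<nu> j v *\<^sub>R v)" for j
    proof -
      have "(\<Sum>r\<in>I. s j r *\<^sub>R y r) = (\<Sum>r\<in>I. \<Sum>v\<in>F. (s j r * w r v) *\<^sub>R v)"
        by (intro sum.cong refl) (simp add: wy flip: scaleR_scaleR scaleR_sum_right)
      also have "\<dots> = (\<Sum>v\<in>F. \<nu> j v *\<^sub>R v)"
        unfolding \<nu>_def scaleR_sum_left by (rule sum.swap)
      finally show ?thesis .
    qed
    have "q (\<Sum>j<n. a j - (\<Sum>r\<in>I. s j r *\<^sub>R y r)) \<le> Q + real (card F) * Q" for n
    proof -
      have "(\<Sum>j<n. a j - (\<Sum>r\<in>I. s j r *\<^sub>R y r)) = (\<Sum>j<n. \<Sum>v\<in>F. (of_bool (a j = v) - \<nu> j v) *\<^sub>R v)"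
        unfolding scaleR_diff_left sum_subtractf by (simp only: \<nu>y flip: av)
      also have "\<dots> = (\<Sum>v\<in>F. (- (\<Sum>j<n. \<nu> j v - of_bool (a j = v))) *\<^sub>R v)"
        by (subst sum.swap) (simp only: minus_diff_eq flip: sum_negf scaleR_sum_left)
      also have "q \<dots> \<le> (\<Sum>v\<in>F. q ((- (\<Sum>j<n. \<nu> j v - of_bool (a j = v))) *\<^sub>R v))"
        by (rule seminorm_sum[OF q])
      also have "\<dots> \<le> (\<Sum>v\<in>F. real (card F) * q v)"
        unfolding seminorm_scaleR[OF q] abs_minus_cancel
        by (intro sum_mono mult_right_mono disc q0)
      also have "\<dots> \<le> Q + real (card F) * Q"
        using Q0 by (simp add: Q_def sum_distrib_left)
      finally show ?thesis .
    qed
    moreover have "a j \<in> A \<and> q (a j) \<le> Q + real (card F) * Q" for j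
    proof -
      have "q (a j) \<le> Q"
        unfolding Q_def using F a q0 by (intro member_le_sum) auto
      moreover have "0 \<le> real (card F) * Q"
        using Q0 by simp
      ultimately show ?thesis
        using F a[of j] by (auto intro: order_trans)
    qed
    ultimately show "\<exists>a. (\<forall>j. a j \<in> A \<and> q (a j) \<le> Q + real (card F) * Q) \<and>
        (\<forall>n. q (\<Sum>j<n. a j - (\<Sum>r\<in>I. s j r *\<^sub>R y r)) \<le> Q + real (card F) * Q)"
      by blast
  qed
qed

section \<open>Steering finitely many iterates at one index\<close>

text \<open>All large \<open>m\<close> work, so \<open>m\<close> can later be taken from an infinite
  set. Keeping the first \<open>N\<close> values costs a bounded amount in the partial sums, which
  averaging removes.\<close>

lemma prefix_extension:
  fixes x \<theta> :: "nat \<Rightarrow> 'v::real_vector"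
  assumes q: "seminorm q" and dense: "\<And>v \<epsilon>. 0 < \<epsilon> \<Longrightarrow> \<exists>y\<in>convex hull A. q (y - v) < \<epsilon>"
    and \<theta>: "\<theta> \<in> UNIV \<rightarrow> A" and "0 < \<epsilon>"
  shows "\<forall>\<^sub>F m in sequentially. \<exists>\<theta>'\<in>UNIV \<rightarrow> A. (\<forall>j<N. \<theta>' j = \<theta> j) \<and>
    (\<forall>k<K. q ((cesaro ^^ Suc k) \<theta>' m - x k) < \<epsilon>)"
proof -
  have q0: "0 \<le> q v" for v
    using seminorm_ge_0[OF q] .
  \<comment> \<open>One half is for approximating from the convex hull, the other for the part that
    decays with \<open>m\<close>.\<close>
  define \<delta> where "\<delta> = \<epsilon> / 2"
  have \<delta>: "0 < \<delta>"
    using \<open>0 < \<epsilon>\<close> by (simp add: \<delta>_def)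
  have "inj_on (\<lambda>r. 1 / real (Suc r)) {..<K}"
    by (auto simp: inj_on_def)
  from vandermonde_solvable[OF this, of x] obtain c0 where
    c0: "\<And>k. k < K \<Longrightarrow> (\<Sum>r<K. (1 / real (Suc r)) ^ k *\<^sub>R c0 r) = x k"
    by blast
  \<comment> \<open>The controlled iterates have numbers 1 to \<open>K\<close>, but the Vandermonde
    system starts with power 0; the factor \<open>Suc r\<close> cancels the extra
    eigenvalue.\<close>
  define c where "c r = real (Suc r) *\<^sub>R c0 r" for r
  have c: "(\<Sum>r<K. (1 / real (Suc r)) ^ Suc k *\<^sub>R c r) = x k" if "k < K" for k
    unfolding c0[OF that, symmetric] by (intro sum.cong refl) (simp add: c_def del: of_nat_Suc)
  \<comment> \<open>The convex weights will be \<open>t j r / K\<close>, hence the factor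
    \<open>K\<close>. The additional index \<open>K\<close> carries the vector 0 and absorbs the
    remaining weight.\<close>
  define v where "v r = (if r < K then real K *\<^sub>R c r else 0)" for r
  obtain y where y: "\<And>r. y r \<in> convex hull A" "\<And>r. q (y r - v r) < \<delta>"
  proof -
    have "\<forall>r. \<exists>y. y \<in> convex hull A \<and> q (y - v r) < \<delta>"
      using dense[OF \<delta>] by blast
    then show ?thesis
      using that by (auto dest!: choice)
  qed
  \<comment> \<open>\<open>C\<close> is fixed before \<open>m\<close>, although the weights will
    depend on \<open>m\<close>; so the error really tends to 0.\<close>
  obtain C where C0: "0 \<le> C"
    and C: "\<forall>s :: nat \<Rightarrow> nat \<Rightarrow> real.
      (\<forall>j. (\<forall>r\<in>{..K}. 0 \<le> s j r) \<and> (\<Sum>r\<le>K. s j r) = 1) \<longrightarrow>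
      (\<exists>a. (\<forall>j. a j \<in> A \<and> q (a j) \<le> C) \<and>
        (\<forall>n. q (\<Sum>j<n. a j - (\<Sum>r\<le>K. s j r *\<^sub>R y r)) \<le> C))"
    using convex_hull_rounding[OF q finite_atMost[of K], of y, OF y(1)] by (elim exE conjE)
  \<comment> \<open>The sum pays for the kept prefix, the last \<open>C\<close> for the
    rounding.\<close>
  define B where "B = (\<Sum>j<N. q (\<theta> j) + C) + C"
  have B0: "0 \<le> B"
    unfolding B_def using q0 C0 by (intro add_nonneg_nonneg sum_nonneg) auto
  have "(\<lambda>m. 2 ^ K * B / sqrt (real (Suc m))) \<longlonglongrightarrow> 0"
    by (rule tendsto_divide_0[OF tendsto_const filterlim_at_top_imp_at_infinity[OF
          filterlim_compose[OF sqrt_at_top filterlim_compose[OF filterlim_real_sequentially filterlim_Suc]]]])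
  then have "\<forall>\<^sub>F m in sequentially. 2 ^ K * B / sqrt (real (Suc m)) < \<delta>"
    using \<delta> by (rule order_tendstoD)
  then show ?thesis
    using eventually_ge_at_top[of K]
  proof eventually_elim
    case (elim m)
    \<comment> \<open>Capping at \<open>m\<close> keeps the coefficients in [0, 1] at every
      position; positions beyond \<open>m\<close> do not affect iterates at
      \<open>m\<close>.\<close>
    define t where "t j r = real (min j m choose r) / real (m choose r)" for j r
    define s where "s j r = (if r < K then t j r / real K else 1 - (\<Sum>i<K. t j i / real K))" for j r
    define f where "f j = (\<Sum>r<K. t j r *\<^sub>R c r)" for j
    have t: "0 \<le> t j r" "t j r \<le> 1" for j r
    proof -
      have "real (min j m choose r) \<le> real (m choose r)"
        by (simp add: binomial_right_mono)
      then show "0 \<le> t j r" "t j r \<le> 1"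
        unfolding t_def by (auto intro: divide_le_eq_1[THEN iffD2])
    qed
    have "(\<Sum>i<K. t j i / real K) \<le> 1" for j
    proof -
      have "(\<Sum>i<K. t j i / real K) \<le> (\<Sum>i<K. 1 / real K)"
        by (intro sum_mono divide_right_mono t) auto
      also have "\<dots> \<le> 1" by simp
      finally show ?thesis .
    qed
    then have s0: "0 \<le> s j r" for j r
      using t by (simp add: s_def)
    have s1: "(\<Sum>r\<le>K. s j r) = 1" for j
      by (simp add: s_def lessThan_Suc_atMost[symmetric])
    have f: "f j = (\<Sum>r\<le>K. s j r *\<^sub>R v r)" for j
      by (auto simp: f_def s_def v_def lessThan_Suc_atMost[symmetric] intro!: sum.cong)
    have "\<exists>a. (\<forall>j. a j \<in> A \<and> q (a j) \<le> C) \<and>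
        (\<forall>n. q (\<Sum>j<n. a j - (\<Sum>r\<le>K. s j r *\<^sub>R y r)) \<le> C)"
      using C[rule_format, of s] s0 s1 by auto
    then obtain a where "\<forall>j. a j \<in> A \<and> q (a j) \<le> C"
      and "\<forall>n. q (\<Sum>j<n. a j - (\<Sum>r\<le>K. s j r *\<^sub>R y r)) \<le> C"
      by (elim exE conjE)
    then have a: "a j \<in> A" "q (a j) \<le> C"
      and disc: "q (\<Sum>j<n. a j - (\<Sum>r\<le>K. s j r *\<^sub>R y r)) \<le> C" for j n
      by blast+
    define \<theta>' where "\<theta>' j = (if j < N then \<theta> j else a j)" for j
    define e where "e j = \<theta>' j - f j" for j
    define g where "g j = (\<Sum>r\<le>K. s j r *\<^sub>R y r)" for j
    have gf: "q (g j - f j) \<le> \<delta>" for j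
    proof -
      have "q (g j - f j) = q (\<Sum>r\<le>K. s j r *\<^sub>R (y r - v r))"
        by (simp add: g_def f scaleR_diff_right sum_subtractf)
      also have "\<dots> \<le> (\<Sum>r\<le>K. s j r * q (y r - v r))"
        using seminorm_sum[OF q, of "\<lambda>r. s j r *\<^sub>R (y r - v r)" "{..K}"] s0
        by (simp add: seminorm_scaleR[OF q])
      also have "\<dots> \<le> (\<Sum>r\<le>K. s j r * \<delta>)"
        by (intro sum_mono mult_left_mono s0 less_imp_le y)
      also have "\<dots> = \<delta>"
        by (simp add: s1 flip: sum_distrib_right)
      finally show ?thesis .
    qed
    have \<theta>'a: "q (\<Sum>j\<le>n. \<theta>' j - a j) \<le> (\<Sum>j<N. q (\<theta> j) + C)" for n
    proof -
      have "q (\<Sum>j\<le>n. \<theta>' j - a j) \<le> (\<Sum>j\<le>n. q (\<theta>' j - a j))"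
        by (rule seminorm_sum[OF q])
      also have "\<dots> \<le> (\<Sum>j\<le>n. if j \<in> {..<N} then q (\<theta> j) + C else 0)"
      proof (rule sum_mono)
        fix j
        show "q (\<theta>' j - a j) \<le> (if j \<in> {..<N} then q (\<theta> j) + C else 0)"
          using seminorm_diff[OF q, of "\<theta> j" "a j"] a(2)[of j] by (simp add: \<theta>'_def seminorm_0[OF q])
      qed
      also have "\<dots> = (\<Sum>j\<in>{..n} \<inter> {..<N}. q (\<theta> j) + C)"
        by (simp add: sum.inter_restrict)
      also have "\<dots> \<le> (\<Sum>j<N. q (\<theta> j) + C)"
        using q0 C0 by (intro sum_mono2) auto
      finally show ?thesis .
    qed
    \<comment> \<open>Single errors \<open>e n\<close> need not be small, but their partial sums are
      bounded up to \<delta> per term, so decay starts with the first mean. The rate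
      \<open>1 / n\<close> is weakened to fit the decay estimate.\<close>
    have e: "q (cesaro e n) \<le> \<delta> + B / sqrt (real (Suc n))" for n
    proof -
      have "(\<Sum>j\<le>n. e j) = (\<Sum>j\<le>n. \<theta>' j - a j) + (\<Sum>j\<le>n. a j - g j) + (\<Sum>j\<le>n. g j - f j)"
        by (simp add: e_def flip: sum.distrib)
      also have "q \<dots> \<le> q (\<Sum>j\<le>n. \<theta>' j - a j) + q (\<Sum>j\<le>n. a j - g j) + q (\<Sum>j\<le>n. g j - f j)"
        by (intro order_trans[OF seminorm_add[OF q]] add_right_mono seminorm_add[OF q])
      also have "\<dots> \<le> (\<Sum>j<N. q (\<theta> j) + C) + C + real (Suc n) * \<delta>"
      proof (intro add_mono \<theta>'a)
        show "q (\<Sum>j\<le>n. a j - g j) \<le> C"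
          using disc[of "Suc n"] by (simp only: g_def lessThan_Suc_atMost)
        show "q (\<Sum>j\<le>n. g j - f j) \<le> real (Suc n) * \<delta>"
          using seminorm_sum[OF q, of "\<lambda>j. g j - f j" "{..n}"] sum_mono[of "{..n}" "\<lambda>j. q (g j - f j)" "\<lambda>_. \<delta>"] gf
          by simp
      qed
      finally have "q (\<Sum>j\<le>n. e j) \<le> B + real (Suc n) * \<delta>"
        by (simp add: B_def)
      then have "q (cesaro e n) \<le> \<delta> + B / real (Suc n)"
        by (simp add: cesaro_eq seminorm_scaleR[OF q] field_simps del: of_nat_Suc)
      also have "\<dots> \<le> \<delta> + B / sqrt (real (Suc n))"
        using B0 real_sqrt_le_iff[of "real (Suc n)" "(real (Suc n))\<^sup>2"]
        by (intro add_left_mono divide_left_mono) (auto simp: power2_eq_square)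
      finally show ?thesis .
    qed
    have "q ((cesaro ^^ Suc k) \<theta>' m - x k) < \<epsilon>" if "k < K" for k
    proof -
      \<comment> \<open>Up to \<open>m\<close>, \<open>f\<close> is a combination of eigenvectors;
        \<open>K \<le> m\<close> makes the divisors \<open>m choose r\<close> nonzero.\<close>
      have "(cesaro ^^ Suc k) f m =
          (cesaro ^^ Suc k) (\<lambda>j. \<Sum>r<K. real (j choose r) *\<^sub>R ((1 / real (m choose r)) *\<^sub>R c r)) m"
        by (rule cesaro_funpow_cong) (simp add: f_def t_def)
      also have "\<dots> = (\<Sum>r<K. (1 / real (Suc r)) ^ Suc k *\<^sub>R c r)"
        unfolding cesaro_funpow_binomial using elim by (intro sum.cong refl) simp
      also have "\<dots> = x k"
        by (rule c[OF that])
      finally have "(cesaro ^^ Suc k) \<theta>' m - x k = (cesaro ^^ Suc k) e m"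
        unfolding e_def cesaro_funpow_diff by simp
      \<comment> \<open>One of the \<open>Suc k\<close> iterations is already contained in
        \<open>cesaro e\<close>.\<close>
      then have "q ((cesaro ^^ Suc k) \<theta>' m - x k) \<le> \<delta> + 2 ^ k * B / sqrt (real (Suc m))"
        using seminorm_cesaro_funpow_le[OF q B0 e, of k m] by (simp only: funpow_Suc_right o_apply)
      also have "\<dots> \<le> \<delta> + 2 ^ K * B / sqrt (real (Suc m))"
        using B0 that by (intro add_left_mono divide_right_mono mult_right_mono power_increasing) auto
      finally show ?thesis
        using elim(1) unfolding \<delta>_def by linarith
    qed
    moreover have "\<theta>' \<in> UNIV \<rightarrow> A" "\<forall>j<N. \<theta>' j = \<theta> j"
      using \<theta> a by (auto simp: \<theta>'_def)
    ultimately show ?case by blast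
  qed
qed

section \<open>The metric and its seminorms\<close>

text \<open>Upper bound: terms before \<open>n\<close> are at most the seminorms, and the others
  have a geometric tail. Lower bound: one term of a nonnegative series is at most its sum.\<close>

lemma
  assumes "lc_metric_space p"
  shows lc_metric_seminorm: "seminorm (p i)"
    and lc_metric_dist_le: "dist x y \<le> (\<Sum>i<n. p i (x - y)) + (1/2) ^ n"
    and lc_metric_dist_ge: "p i (x - y) / (1 + p i (x - y)) \<le> 2 ^ Suc i * dist x y"
proof -
  have p: "seminorm (p i)" for i
    using assms by (simp add: lc_metric_space_def)
  then show "seminorm (p i)" .
  have p0: "0 \<le> p i v" for i v
    using seminorm_ge_0[OF p] .
  define h where "h i = 1 / 2 ^ Suc i * (p i (x - y) / (1 + p i (x - y)))" for i
  have d: "dist x y = (\<Sum>i. h i)"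
    using assms by (simp add: lc_metric_space_def seminorm_metric_def h_def)
  have frac: "p i v / (1 + p i v) \<le> 1" "p i v / (1 + p i v) \<le> p i v" "0 \<le> p i v / (1 + p i v)" for i v
    using p0[of i v] divide_left_mono[of 1 "1 + p i v" "p i v"] by simp_all
  have h0: "0 \<le> h i" for i
    unfolding h_def by (intro mult_nonneg_nonneg frac) simp
  have h_geo: "h i \<le> (1/2) ^ Suc i" for i
    using mult_left_mono[OF frac(1), of "1 / 2 ^ Suc i"] unfolding h_def by (simp add: power_divide)
  have h_le_p: "h i \<le> p i (x - y)" for i
  proof -
    have "1 / 2 ^ Suc i \<le> (1::real)"
      by (simp add: divide_le_eq_1 one_le_power del: power_Suc)
    then show ?thesis
      unfolding h_def using mult_mono[OF _ frac(2)[of i "x - y"], of "1 / 2 ^ Suc i" 1] frac(3) by simp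
  qed
  have "summable (\<lambda>i. (1/2::real) ^ Suc i)"
    by (simp add: summable_mult summable_geometric)
  then have h_summable: "summable h"
    by (rule summable_comparison_test'[where N = 0]) (use h0 h_geo in auto)
  have "h i \<le> dist x y"
    unfolding d using sum_le_suminf[OF h_summable, of "{i}"] h0 by simp
  then have "2 ^ Suc i * h i \<le> 2 ^ Suc i * dist x y"
    by (rule mult_left_mono) simp
  then show "p i (x - y) / (1 + p i (x - y)) \<le> 2 ^ Suc i * dist x y"
    by (simp add: h_def del: power_Suc)
  have "dist x y = (\<Sum>i. h (i + n)) + (\<Sum>i<n. h i)"
    unfolding d by (rule suminf_split_initial_segment[OF h_summable])
  also have "(\<Sum>i. h (i + n)) \<le> (\<Sum>i. (1/2) ^ Suc n * (1/2) ^ i)"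
  proof (rule suminf_le)
    show "h (i + n) \<le> (1/2) ^ Suc n * (1/2) ^ i" for i
      using h_geo[of "i + n"] by (simp add: power_add mult.commute)
    show "summable (\<lambda>i. h (i + n))"
      using h_summable by (rule summable_ignore_initial_segment)
    show "summable (\<lambda>i. (1/2::real) ^ Suc n * (1/2) ^ i)"
      by (intro summable_mult summable_geometric) simp
  qed
  also have "(\<Sum>i. (1/2::real) ^ Suc n * (1/2) ^ i) = (1/2) ^ n"
    by (subst suminf_mult) (simp_all add: summable_geometric suminf_geometric)
  also have "(\<Sum>i<n. h i) \<le> (\<Sum>i<n. p i (x - y))"
    by (intro sum_mono h_le_p)
  finally show "dist x y \<le> (\<Sum>i<n. p i (x - y)) + (1/2) ^ n"
    by simp
qed

text \<open>The type class does not relate the metric to the vector operations; their continuity is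
  derived through this reduction.\<close>

lemma lc_metric_tendsto_iff:
  assumes lc: "lc_metric_space p"
  shows "(f \<longlongrightarrow> l) F \<longleftrightarrow> (\<forall>i. ((\<lambda>x. p i (f x - l)) \<longlongrightarrow> 0) F)"
proof (intro iffI allI)
  fix i
  assume "(f \<longlongrightarrow> l) F"
  then have lim: "((\<lambda>x. 2 ^ Suc i * dist (f x) l) \<longlongrightarrow> 0) F"
    by (intro tendsto_mult_right_zero tendsto_dist_iff[THEN iffD1])
  \<comment> \<open>Below 1/2 the bound \<open>b / (1 + b) \<le> u\<close> can be solved for
    \<open>b\<close>, giving \<open>b \<le> 2 * u\<close>.\<close>
  then have "\<forall>\<^sub>F x in F. 2 ^ Suc i * dist (f x) l < 1 / 2"
    by (rule order_tendstoD) simp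
  then have "\<forall>\<^sub>F x in F. norm (p i (f x - l)) \<le> 2 * (2 ^ Suc i * dist (f x) l)"
  proof eventually_elim
    case (elim x)
    define u b where "u = 2 ^ Suc i * dist (f x) l" and "b = p i (f x - l)"
    have b0: "0 \<le> b"
      unfolding b_def by (rule seminorm_ge_0[OF lc_metric_seminorm[OF lc]])
    have "b / (1 + b) \<le> u"
      unfolding u_def b_def by (rule lc_metric_dist_ge[OF lc])
    then have "b \<le> u * (1 + b)"
      using b0 by (simp add: divide_le_eq)
    also have "\<dots> = u + u * b"
      by (rule distrib_left[of u 1 b, simplified])
    also have "\<dots> \<le> u + 1 / 2 * b"
      using elim b0 unfolding u_def[symmetric] by (intro add_left_mono mult_right_mono) auto
    finally have "norm b \<le> 2 * u"
      using b0 by simp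
    then show ?case
      unfolding u_def b_def .
  qed
  then show "((\<lambda>x. p i (f x - l)) \<longlongrightarrow> 0) F"
    by (rule Lim_null_comparison) (rule tendsto_mult_right_zero[OF lim])
next
  assume lim: "\<forall>i. ((\<lambda>x. p i (f x - l)) \<longlongrightarrow> 0) F"
  show "(f \<longlongrightarrow> l) F"
  proof (rule tendstoI)
    fix e :: real
    assume "0 < e"
    then obtain n where n: "(1/2::real) ^ n < e / 2"
      using real_arch_pow_inv[of "e / 2" "1/2"] by auto
    have "((\<lambda>x. \<Sum>i<n. p i (f x - l)) \<longlongrightarrow> 0) F"
      using lim by (intro tendsto_null_sum) simp
    then have "\<forall>\<^sub>F x in F. (\<Sum>i<n. p i (f x - l)) < e / 2"
      using \<open>0 < e\<close> by (intro order_tendstoD) auto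
    then show "\<forall>\<^sub>F x in F. dist (f x) l < e"
    proof eventually_elim
      case (elim x)
      then show ?case
        using lc_metric_dist_le[OF lc, of "f x" l n] n by linarith
    qed
  qed
qed

lemma lc_metric_tendsto_add:
  fixes p :: "nat \<Rightarrow> 'v::{real_vector, metric_space} \<Rightarrow> real" and a b :: 'v
  assumes lc: "lc_metric_space p" and "(f \<longlongrightarrow> a) F" "(g \<longlongrightarrow> b) F"
  shows "((\<lambda>x. f x + g x) \<longlongrightarrow> a + b) F"
  unfolding lc_metric_tendsto_iff[OF lc]
proof
  fix i
  have p: "seminorm (p i)"
    by (rule lc_metric_seminorm[OF lc])
  have fa: "((\<lambda>x. p i (f x - a)) \<longlongrightarrow> 0) F" and gb: "((\<lambda>x. p i (g x - b)) \<longlongrightarrow> 0) F"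
    using lc_metric_tendsto_iff[OF lc, of f a F] lc_metric_tendsto_iff[OF lc, of g b F] assms(2,3)
    by blast+
  show "((\<lambda>x. p i (f x + g x - (a + b))) \<longlongrightarrow> 0) F"
  proof (rule Lim_null_comparison[OF always_eventually tendsto_add_zero[OF fa gb]], rule allI)
    fix x
    show "norm (p i (f x + g x - (a + b))) \<le> p i (f x - a) + p i (g x - b)"
      using seminorm_add[OF p, of "f x - a" "g x - b"] seminorm_ge_0[OF p, of "f x + g x - (a + b)"]
      by (simp add: add_diff_add)
  qed
qed

lemma lc_metric_tendsto_scaleR:
  fixes p :: "nat \<Rightarrow> 'v::{real_vector, metric_space} \<Rightarrow> real" and a :: 'v
  assumes lc: "lc_metric_space p" and "(f \<longlongrightarrow> a) F"
  shows "((\<lambda>x. c *\<^sub>R f x) \<longlongrightarrow> c *\<^sub>R a) F"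
  using assms(2)
  unfolding lc_metric_tendsto_iff[OF lc] scaleR_diff_right[symmetric]
    seminorm_scaleR[OF lc_metric_seminorm[OF lc]]
  by (intro allI tendsto_mult_right_zero) (rule spec)

lemma lc_metric_tendsto_sum:
  fixes p :: "nat \<Rightarrow> 'v::{real_vector, metric_space} \<Rightarrow> real" and a :: "'i \<Rightarrow> 'v"
  assumes lc: "lc_metric_space p" and "\<And>i. i \<in> I \<Longrightarrow> (f i \<longlongrightarrow> a i) F"
  shows "((\<lambda>x. \<Sum>i\<in>I. f i x) \<longlongrightarrow> (\<Sum>i\<in>I. a i)) F"
  using assms(2)
proof (induction I rule: infinite_finite_induct)
  case (insert i I)
  then show ?case
    by (simp add: lc_metric_tendsto_add[OF lc])
qed simp_all

section \<open>The sequence space and its open conditions\<close>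

lemma topspace_seq_topology [simp]: "topspace (seq_topology A) = UNIV \<rightarrow> A"
  by (simp add: seq_topology_def PiE_UNIV_domain)

lemma continuous_map_cesaro_funpow:
  fixes p :: "nat \<Rightarrow> 'v::{real_vector, metric_space} \<Rightarrow> real" and A :: "'v set"
  assumes lc: "lc_metric_space p"
  shows "continuous_map (seq_topology A) euclidean (\<lambda>\<theta>. (cesaro ^^ k) \<theta> n)"
proof (induction k arbitrary: n)
  case 0
  have "continuous_map (seq_topology A) (top_of_set A) (\<lambda>\<theta>. \<theta> n)"
    unfolding seq_topology_def by (rule continuous_map_product_projection) simp
  then show ?case
    by (simp add: continuous_map_in_subtopology)
next
  case (Suc k)
  then show ?case
    unfolding continuous_map_atin limitin_canonical_iff cesaro_funpow_Suc
    by (intro ballI lc_metric_tendsto_scaleR[OF lc] lc_metric_tendsto_sum[OF lc]) auto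
qed

text \<open>Tying the tolerance to the length of the list makes the lists alone index all the conditions.\<close>

definition near_targets :: "nat set \<Rightarrow> 'v list \<Rightarrow> (nat \<Rightarrow> 'v::{real_vector, metric_space}) \<Rightarrow> bool" where
  "near_targets M xs \<theta> \<longleftrightarrow> (\<exists>m\<in>M. \<forall>k<length xs.
     dist ((cesaro ^^ Suc k) \<theta> (m - 1)) (xs ! k) < 1 / real (Suc (length xs)))"

lemma openin_near_targets:
  fixes p :: "nat \<Rightarrow> 'v::{real_vector, metric_space} \<Rightarrow> real" and A :: "'v set"
  assumes lc: "lc_metric_space p"
  shows "openin (seq_topology A) {\<theta> \<in> UNIV \<rightarrow> A. near_targets M xs \<theta>}"
proof -
  define U where "U m k = {\<theta> \<in> topspace (seq_topology A).
    (cesaro ^^ Suc k) \<theta> (m - 1) \<in> ball (xs ! k) (1 / real (Suc (length xs)))}" for m k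
  have "openin (seq_topology A) (U m k)" for m k
    unfolding U_def
    by (rule openin_continuous_map_preimage[OF continuous_map_cesaro_funpow[OF lc]]) simp
  \<comment> \<open>For the empty list the inner intersection is \<open>UNIV\<close>, so it is cut
    down to the space.\<close>
  then have "openin (seq_topology A)
      (\<Union>m\<in>M. (\<Inter>k\<in>{..<length xs}. U m k) \<inter> topspace (seq_topology A))"
    by (intro openin_clauses(3)) (auto intro!: openin_INT simp del: topspace_seq_topology)
  also have "(\<Union>m\<in>M. (\<Inter>k\<in>{..<length xs}. U m k) \<inter> topspace (seq_topology A)) =
      {\<theta> \<in> UNIV \<rightarrow> A. near_targets M xs \<theta>}"
    by (auto simp: near_targets_def U_def dist_commute simp del: funpow.simps)
  finally show ?thesis .
qed

section \<open>Theta as an intersection over finite target lists\<close>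

lemma Theta_iff:
  "\<theta> \<in> Theta A M \<longleftrightarrow> \<theta> \<in> UNIV \<rightarrow> A \<and>
    (\<forall>x. \<exists>l. (\<forall>n. l n \<in> M) \<and> (\<forall>k. (\<lambda>n. (cesaro ^^ Suc k) \<theta> (l n - 1)) \<longlonglongrightarrow> x k))"
proof -
  have "(\<forall>k\<ge>1. R k) \<longleftrightarrow> (\<forall>k. R (Suc k))" for R :: "nat \<Rightarrow> bool"
    by (metis One_nat_def Suc_le_D Suc_le_mono le0)
  then show ?thesis
    unfolding Theta_def seq_term_def by (simp only: mem_Collect_eq diff_Suc_1)
qed

lemmas Theta_tendsto = Theta_iff[THEN iffD1, THEN conjunct2, THEN spec]

text \<open>For the converse, \<open>l n\<close> serves the first \<open>n\<close> targets,
  approximated from \<open>D\<close>. Longer lists have smaller tolerance, so each fixed iterate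
  converges along \<open>l\<close>.\<close>

lemma Theta_eq:
  assumes D: "\<And>x e. 0 < e \<Longrightarrow> \<exists>d\<in>D. dist d x < e"
  shows "Theta A M = {\<theta> \<in> UNIV \<rightarrow> A. \<forall>xs\<in>lists D. near_targets M xs \<theta>}"
proof (intro equalityI subsetI)
  fix \<theta>
  assume \<theta>: "\<theta> \<in> Theta A M"
  have "near_targets M xs \<theta>" for xs
  proof -
    define \<epsilon> where "\<epsilon> = 1 / real (Suc (length xs))"
    have "0 < \<epsilon>"
      by (simp add: \<epsilon>_def)
    have "\<exists>l. (\<forall>n. l n \<in> M) \<and> (\<forall>k. (\<lambda>n. (cesaro ^^ Suc k) \<theta> (l n - 1)) \<longlonglongrightarrow> xs ! k)"
      by (rule Theta_tendsto[OF \<theta>])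
    then obtain l where l: "\<forall>n. l n \<in> M"
      and lim: "\<forall>k. (\<lambda>n. (cesaro ^^ Suc k) \<theta> (l n - 1)) \<longlonglongrightarrow> xs ! k"
      by (elim exE conjE)
    have ev: "\<forall>\<^sub>F n in sequentially. \<forall>k\<in>{..<length xs}. dist ((cesaro ^^ Suc k) \<theta> (l n - 1)) (xs ! k) < \<epsilon>"
      by (intro eventually_ball_finite ballI finite_lessThan tendstoD[OF spec[OF lim] \<open>0 < \<epsilon>\<close>])
    obtain n where "\<forall>k\<in>{..<length xs}. dist ((cesaro ^^ Suc k) \<theta> (l n - 1)) (xs ! k) < \<epsilon>"
      using eventually_happens'[OF sequentially_bot ev] by (elim exE)
    then show ?thesis
      unfolding near_targets_def \<epsilon>_def by (intro bexI[OF _ spec[OF l, of n]]) simp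
  qed
  with \<theta> show "\<theta> \<in> {\<theta> \<in> UNIV \<rightarrow> A. \<forall>xs\<in>lists D. near_targets M xs \<theta>}"
    by (simp add: Theta_def)
next
  fix \<theta>
  assume \<theta>: "\<theta> \<in> {\<theta> \<in> UNIV \<rightarrow> A. \<forall>xs\<in>lists D. near_targets M xs \<theta>}"
  have "\<exists>l. (\<forall>n. l n \<in> M) \<and> (\<forall>k. (\<lambda>n. (cesaro ^^ Suc k) \<theta> (l n - 1)) \<longlonglongrightarrow> x k)" for x
  proof -
    have "\<exists>m. m \<in> M \<and> (\<forall>k<n. dist ((cesaro ^^ Suc k) \<theta> (m - 1)) (x k) < 2 / real (Suc n))" for n
    proof -
      define \<epsilon> where "\<epsilon> = 1 / real (Suc n)"
      have "0 < \<epsilon>"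
        by (simp add: \<epsilon>_def)
      have "\<forall>k. \<exists>d. d \<in> D \<and> dist d (x k) < \<epsilon>"
        unfolding Bex_def[symmetric] by (intro allI D \<open>0 < \<epsilon>\<close>)
      from choice[OF this] obtain d where d: "\<forall>k. d k \<in> D \<and> dist (d k) (x k) < \<epsilon>"
        by (elim exE)
      \<comment> \<open>Its length \<open>n\<close> gives the tolerance \<open>1 / Suc n\<close>,
        equal to the error made in replacing targets by points of \<open>D\<close>.\<close>
      have "map d [0..<n] \<in> lists D"
        using d by auto
      then have "near_targets M (map d [0..<n]) \<theta>"
        using \<theta> by blast
      then obtain m where "m \<in> M"
        and m: "\<forall>k<n. dist ((cesaro ^^ Suc k) \<theta> (m - 1)) (map d [0..<n] ! k) < \<epsilon>"
        unfolding near_targets_def \<epsilon>_def length_map length_upt minus_nat.diff_0 by (elim bexE)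
      have "dist ((cesaro ^^ Suc k) \<theta> (m - 1)) (x k) < 2 / real (Suc n)" if "k < n" for k
      proof -
        have "dist ((cesaro ^^ Suc k) \<theta> (m - 1)) (x k) \<le>
            dist ((cesaro ^^ Suc k) \<theta> (m - 1)) (d k) + dist (d k) (x k)"
          by (rule dist_triangle)
        also have "\<dots> < \<epsilon> + \<epsilon>"
        proof (rule add_strict_mono)
          show "dist ((cesaro ^^ Suc k) \<theta> (m - 1)) (d k) < \<epsilon>"
            using m[rule_format, OF that] that by (simp del: funpow.simps)
          show "dist (d k) (x k) < \<epsilon>"
            using d by blast
        qed
        also have "\<dots> = 2 / real (Suc n)"
          by (simp add: \<epsilon>_def)
        finally show ?thesis .
      qed
      then show ?thesis
        using \<open>m \<in> M\<close> by (intro exI[of _ m]) blast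
    qed
    then have "\<forall>n. \<exists>m. m \<in> M \<and> (\<forall>k<n. dist ((cesaro ^^ Suc k) \<theta> (m - 1)) (x k) < 2 / real (Suc n))"
      by (rule allI)
    from choice[OF this] obtain l where l: "\<forall>n. l n \<in> M \<and>
        (\<forall>k<n. dist ((cesaro ^^ Suc k) \<theta> (l n - 1)) (x k) < 2 / real (Suc n))"
      by (elim exE)
    have "(\<lambda>n. (cesaro ^^ Suc k) \<theta> (l n - 1)) \<longlonglongrightarrow> x k" for k
    proof -
      have "\<forall>\<^sub>F n in sequentially. norm (dist ((cesaro ^^ Suc k) \<theta> (l n - 1)) (x k)) \<le> 2 / real (Suc n)"
        using eventually_gt_at_top[of k]
      proof eventually_elim
        case (elim n)
        then have "dist ((cesaro ^^ Suc k) \<theta> (l n - 1)) (x k) < 2 / real (Suc n)"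
          using l by blast
        then show ?case
          unfolding real_norm_def abs_of_nonneg[OF zero_le_dist] by (rule less_imp_le)
      qed
      then show ?thesis
        by (rule tendsto_dist_iff[THEN iffD2, OF Lim_null_comparison[OF _ LIMSEQ_Suc[OF lim_const_over_n]]])
    qed
    with l show ?thesis
      by (intro exI[of _ l] conjI allI) simp_all
  qed
  moreover have "\<theta> \<in> UNIV \<rightarrow> A"
    using \<theta> by blast
  ultimately show "\<theta> \<in> Theta A M"
    unfolding Theta_iff by (intro conjI allI)
qed

section \<open>Density by successive extension of prefixes\<close>

text \<open>The condition is forced for every sequence that shares the new prefix, so later
  extensions cannot destroy it.\<close>

lemma near_targets_extension:
  fixes p :: "nat \<Rightarrow> 'v::{real_vector, metric_space} \<Rightarrow> real" and A :: "'v set"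
  assumes lc: "lc_metric_space p" and M: "infinite M" and A: "closure (convex hull A) = UNIV"
    and \<theta>: "\<theta> \<in> UNIV \<rightarrow> A"
  shows "\<exists>\<theta>'\<in>UNIV \<rightarrow> A. \<exists>N'>N. (\<forall>j<N. \<theta>' j = \<theta> j) \<and>
    (\<forall>\<phi>. (\<forall>j<N'. \<phi> j = \<theta>' j) \<longrightarrow> near_targets M xs \<phi>)"
proof -
  \<comment> \<open>Half the tolerance: one \<epsilon> for the seminorms below \<open>n\<close>, one
    for the tail of the metric.\<close>
  define \<epsilon> where "\<epsilon> = 1 / (2 * real (Suc (length xs)))"
  have \<epsilon>: "0 < \<epsilon>"
    by (simp add: \<epsilon>_def)
  obtain n where n: "(1/2::real) ^ n < \<epsilon>"
    using real_arch_pow_inv[OF \<epsilon>, of "1/2"] by auto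
  define q where "q v = (\<Sum>i<n. p i v)" for v
  have p: "seminorm (p i)" for i
    by (rule lc_metric_seminorm[OF lc])
  have q: "seminorm q"
    unfolding seminorm_def q_def
    by (auto simp: seminorm_scaleR[OF p] sum_distrib_left simp flip: sum.distrib
        intro!: sum_nonneg sum_mono seminorm_ge_0[OF p] seminorm_add[OF p])
  have dense: "\<exists>y\<in>convex hull A. q (y - v) < e" if "0 < e" for v e
  proof -
    have "v \<in> closure (convex hull A)"
      using A by simp
    then obtain f where f: "\<And>i. f i \<in> convex hull A" and "f \<longlonglongrightarrow> v"
      unfolding closure_sequential by blast
    then have "(\<lambda>i. q (f i - v)) \<longlonglongrightarrow> 0"
      unfolding q_def lc_metric_tendsto_iff[OF lc] by (intro tendsto_null_sum) blast
    from order_tendstoD(2)[OF this \<open>0 < e\<close>] obtain i where "q (f i - v) < e"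
      using eventually_happens trivial_limit_sequentially by blast
    with f show ?thesis by blast
  qed
  obtain m0 where m0: "\<And>m. m0 \<le> m \<Longrightarrow> \<exists>\<theta>'\<in>UNIV \<rightarrow> A. (\<forall>j<N. \<theta>' j = \<theta> j) \<and>
      (\<forall>k<length xs. q ((cesaro ^^ Suc k) \<theta>' m - xs ! k) < \<epsilon>)"
    using prefix_extension[OF q dense \<theta> \<epsilon>, of N "length xs" "(!) xs"]
    unfolding eventually_sequentially by blast
  \<comment> \<open>Index \<open>m'\<close> counts from 1 and is read at position
    \<open>m = m' - 1\<close>. The iterates there depend on positions below \<open>m'\<close>, so
    \<open>m'\<close> is also the new prefix length, and it exceeds \<open>N\<close>.\<close>
  obtain m' where m': "m' \<in> M" "Suc (max m0 N) \<le> m'"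
    using M unfolding infinite_nat_iff_unbounded_le by blast
  define m where "m = m' - 1"
  have m: "m0 \<le> m" "N \<le> m" "m' = Suc m"
    using m' by (auto simp: m_def)
  from m0[OF m(1)] obtain \<theta>' where \<theta>': "\<theta>' \<in> UNIV \<rightarrow> A" "\<forall>j<N. \<theta>' j = \<theta> j"
    and close: "\<And>k. k < length xs \<Longrightarrow> q ((cesaro ^^ Suc k) \<theta>' m - xs ! k) < \<epsilon>"
    by blast
  have "near_targets M xs \<phi>" if \<phi>: "\<forall>j<m'. \<phi> j = \<theta>' j" for \<phi>
    unfolding near_targets_def
  proof (intro bexI[OF _ m'(1)] allI impI)
    fix k
    assume k: "k < length xs"
    have "(cesaro ^^ Suc k) \<phi> (m' - 1) = (cesaro ^^ Suc k) \<phi> m"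
      unfolding m(3) by simp
    also have "\<dots> = (cesaro ^^ Suc k) \<theta>' m"
      by (rule cesaro_funpow_cong) (use \<phi> m(3) in simp)
    finally have "dist ((cesaro ^^ Suc k) \<phi> (m' - 1)) (xs ! k) \<le>
        q ((cesaro ^^ Suc k) \<theta>' m - xs ! k) + (1/2) ^ n"
      using lc_metric_dist_le[OF lc] by (simp only: q_def)
    also have "\<dots> < \<epsilon> + \<epsilon>"
      by (rule add_strict_mono[OF close[OF k] n])
    also have "\<dots> = 1 / real (Suc (length xs))"
      by (simp add: \<epsilon>_def del: of_nat_Suc)
    finally show "dist ((cesaro ^^ Suc k) \<phi> (m' - 1)) (xs ! k) < 1 / real (Suc (length xs))" .
  qed
  with \<theta>' m show ?thesis
    by (intro bexI[of _ \<theta>'] exI[of _ m']) auto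
qed

text \<open>The countably many lists over \<open>D\<close> are handled one per stage. Every
  coordinate is eventually frozen, so the limit exists in the product without completeness of the
  space.\<close>

lemma Theta_extension:
  fixes p :: "nat \<Rightarrow> 'v::{real_vector, metric_space} \<Rightarrow> real" and A D :: "'v set"
  assumes lc: "lc_metric_space p" and M: "infinite M" and A: "closure (convex hull A) = UNIV"
    and D: "countable D" "\<And>x e. 0 < e \<Longrightarrow> \<exists>d\<in>D. dist d x < e"
    and \<theta>: "\<theta> \<in> UNIV \<rightarrow> A"
  shows "\<exists>\<phi>\<in>Theta A M. \<forall>j<N. \<phi> j = \<theta> j"
proof -
  define xs where "xs = from_nat_into (lists D)"
  have xs: "\<exists>n. ys = xs n" if "ys \<in> lists D" for ys
    using from_nat_into_surj[OF countable_lists[OF D(1)] that] by (auto simp: xs_def)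
  \<comment> \<open>A state is a sequence with the length of its frozen prefix; the clause for
    \<open>n = 0\<close> starts from \<theta> and \<open>N\<close>.\<close>
  define P :: "nat \<Rightarrow> (nat \<Rightarrow> 'v) \<times> nat \<Rightarrow> bool" where
    "P n S \<longleftrightarrow> fst S \<in> UNIV \<rightarrow> A \<and> (n = 0 \<longrightarrow> S = (\<theta>, N))" for n S
  define Q :: "nat \<Rightarrow> (nat \<Rightarrow> 'v) \<times> nat \<Rightarrow> (nat \<Rightarrow> 'v) \<times> nat \<Rightarrow> bool" where
    "Q n S S' \<longleftrightarrow> snd S < snd S' \<and> (\<forall>j<snd S. fst S' j = fst S j) \<and>
      (\<forall>\<phi>. (\<forall>j<snd S'. \<phi> j = fst S' j) \<longrightarrow> near_targets M (xs n) \<phi>)" for n S S'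
  have "\<exists>S. \<forall>n. P n (S n) \<and> Q n (S n) (S (Suc n))"
  proof (rule dependent_nat_choice)
    show "\<exists>S. P 0 S"
      using \<theta> by (auto simp: P_def)
    fix S n
    assume "P n S"
    then have "fst S \<in> UNIV \<rightarrow> A"
      by (simp add: P_def)
    from near_targets_extension[OF lc M A this, of "snd S" "xs n"]
    obtain \<theta>' N' where "\<theta>' \<in> UNIV \<rightarrow> A" "snd S < N'" "\<forall>j<snd S. \<theta>' j = fst S j"
      "\<forall>\<phi>. (\<forall>j<N'. \<phi> j = \<theta>' j) \<longrightarrow> near_targets M (xs n) \<phi>"
      by (elim bexE exE conjE)
    then show "\<exists>S'. P (Suc n) S' \<and> Q n S S'"
      unfolding P_def Q_def by (intro exI[of _ "(\<theta>', N')"]) simp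
  qed
  then obtain S where S: "\<And>n. P n (S n)" "\<And>n. Q n (S n) (S (Suc n))"
    by blast
  have less: "snd (S n) < snd (S (Suc n))" for n
    using S(2) by (simp add: Q_def)
  have mono: "snd (S i) \<le> snd (S n)" if "i \<le> n" for i n
    by (rule lift_Suc_mono_le[of "\<lambda>n. snd (S n)", OF less_imp_le[OF less] that])
  have ge: "n \<le> snd (S n)" for n
  proof (induction n)
    case (Suc n)
    then show ?case
      using less[of n] by linarith
  qed simp
  have agree: "fst (S n) j = fst (S i) j" if "i \<le> n" "j < snd (S i)" for i n j
    using that
  proof (induction n rule: dec_induct)
    case (step n)
    have "j < snd (S n)"
      using step mono[of i n] by simp
    then show ?case
      using S(2)[of n] step by (simp add: Q_def)
  qed simp
  \<comment> \<open>Frozen lengths grow strictly, so entry \<open>j\<close> is final from stage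
    \<open>Suc j\<close> on.\<close>
  define \<phi> where "\<phi> j = fst (S (Suc j)) j" for j
  have \<phi>: "\<phi> j = fst (S i) j" if "j < snd (S i)" for i j
    using agree[of i "max i (Suc j)" j] agree[of "Suc j" "max i (Suc j)" j] that ge[of "Suc j"]
    by (simp add: \<phi>_def)
  have "near_targets M ys \<phi>" if "ys \<in> lists D" for ys
  proof -
    from xs[OF that] obtain n where "ys = xs n" ..
    then show ?thesis
      using S(2)[of n] \<phi>[of _ "Suc n"] unfolding Q_def by simp
  qed
  moreover have "\<phi> \<in> UNIV \<rightarrow> A"
  proof
    fix j
    have "fst (S (Suc j)) \<in> UNIV \<rightarrow> A"
      using S(1) by (simp add: P_def)
    then show "\<phi> j \<in> A"
      unfolding \<phi>_def by (rule PiE) simp_all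
  qed
  moreover have "Theta A M = {\<theta> \<in> UNIV \<rightarrow> A. \<forall>xs\<in>lists D. near_targets M xs \<theta>}"
    by (rule Theta_eq) (rule D(2))
  ultimately have "\<phi> \<in> Theta A M"
    by blast
  moreover have "\<phi> j = \<theta> j" if "j < N" for j
    using \<phi>[of j 0] S(1)[of 0] that by (simp add: P_def)
  ultimately show ?thesis by blast
qed

text \<open>A basic open set of the product restricts only finitely many coordinates, all of them
  below some \<open>N\<close>.\<close>

lemma dense_in_seq_topology:
  assumes "S \<subseteq> UNIV \<rightarrow> A"
    and "\<And>\<theta> N. \<theta> \<in> UNIV \<rightarrow> A \<Longrightarrow> \<exists>\<phi>\<in>S. \<forall>j<N. \<phi> j = \<theta> j"
  shows "seq_topology A closure_of S = topspace (seq_topology A)"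
proof (intro equalityI closure_of_subset_topspace subsetI)
  fix \<theta>
  assume \<theta>: "\<theta> \<in> topspace (seq_topology A)"
  show "\<theta> \<in> seq_topology A closure_of S"
    unfolding in_closure_of
  proof (intro conjI \<theta> allI impI)
    fix T
    assume "\<theta> \<in> T \<and> openin (seq_topology A) T"
    then obtain U where fin: "finite {i \<in> UNIV. U i \<noteq> topspace (top_of_set A)}"
      and U: "\<theta> \<in> PiE UNIV U" "PiE UNIV U \<subseteq> T"
      unfolding seq_topology_def openin_product_topology_alt by blast
    then have fin: "finite {i. U i \<noteq> A}"
      by simp
    obtain N where N: "\<And>i. U i \<noteq> A \<Longrightarrow> i < N"
      using finite_nat_set_iff_bounded[THEN iffD1, OF fin] by blast
    obtain \<phi> where \<phi>: "\<phi> \<in> S" "\<forall>j<N. \<phi> j = \<theta> j"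
      using assms(2)[of \<theta> N] \<theta> by auto
    have "\<phi> j \<in> U j" for j
      using N[of j] \<phi> U(1) assms(1) by (cases "j < N") (auto simp: PiE_iff)
    with U(2) \<phi>(1) show "\<exists>y. y \<in> S \<and> y \<in> T"
      by (auto simp: PiE_iff)
  qed
qed

section \<open>Multiples of one element, and the theorem\<close>

lemma Theta_seq_scale:
  fixes p :: "nat \<Rightarrow> 'v::{real_vector, metric_space} \<Rightarrow> real" and A :: "'v set"
  assumes lc: "lc_metric_space p" and A: "subspace A" and \<theta>: "\<theta> \<in> Theta A M" and "c \<noteq> 0"
  shows "seq_scale c \<theta> \<in> Theta A M"
  unfolding Theta_iff
proof (intro conjI allI)
  show "seq_scale c \<theta> \<in> UNIV \<rightarrow> A"
    using \<theta> A by (auto simp: Theta_def seq_scale_def Pi_iff subspace_scale)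
  fix x :: "nat \<Rightarrow> 'v"
  \<comment> \<open>Indices for the targets divided by \<open>c\<close> serve the original targets
    after scaling.\<close>
  have "\<exists>l. (\<forall>n. l n \<in> M) \<and> (\<forall>k. (\<lambda>n. (cesaro ^^ Suc k) \<theta> (l n - 1)) \<longlonglongrightarrow> (1 / c) *\<^sub>R x k)"
    by (rule Theta_tendsto[OF \<theta>])
  then obtain l where l: "\<forall>n. l n \<in> M"
    and lim: "\<forall>k. (\<lambda>n. (cesaro ^^ Suc k) \<theta> (l n - 1)) \<longlonglongrightarrow> (1 / c) *\<^sub>R x k"
    by (elim exE conjE)
  have "(\<lambda>n. (cesaro ^^ Suc k) (seq_scale c \<theta>) (l n - 1)) \<longlonglongrightarrow> x k" for k
    using lc_metric_tendsto_scaleR[OF lc spec[OF lim, of k], of c] \<open>c \<noteq> 0\<close>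
    unfolding seq_scale_def cesaro_funpow_scaleR by simp
  with l show "\<exists>l. (\<forall>n. l n \<in> M) \<and>
      (\<forall>k. (\<lambda>n. (cesaro ^^ Suc k) (seq_scale c \<theta>) (l n - 1)) \<longlonglongrightarrow> x k)"
    by blast
qed

lemma Theta_nonzero:
  fixes \<theta> :: "nat \<Rightarrow> 'v::{real_vector, metric_space}"
  assumes \<theta>: "\<theta> \<in> Theta A M" and V: "(UNIV :: 'v set) \<noteq> {0}"
  shows "\<theta> \<noteq> 0"
proof
  assume "\<theta> = 0"
  obtain v :: 'v where "v \<noteq> 0"
    using V by blast
  have "\<exists>l. (\<forall>n. l n \<in> M) \<and> (\<forall>k. (\<lambda>n. (cesaro ^^ Suc k) \<theta> (l n - 1)) \<longlonglongrightarrow> v)"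
    by (rule Theta_tendsto[OF \<theta>])
  then obtain l where "(\<lambda>n. (cesaro ^^ Suc 0) \<theta> (l n - 1)) \<longlonglongrightarrow> v"
    by blast
  then have "(\<lambda>_. 0) \<longlonglongrightarrow> v"
    by (simp add: \<open>\<theta> = 0\<close> cesaro_eq)
  then show False
    using \<open>v \<noteq> 0\<close> LIMSEQ_unique tendsto_const by blast
qed

theorem theorem4p1:
  fixes p :: "nat \<Rightarrow> 'v::{real_vector, metric_space} \<Rightarrow> real"
    and A :: "'v set" and M :: "nat set"
  assumes "lc_metric_space p"
    and "separable_space (euclidean :: 'v topology)"
    and "M \<subseteq> {1..}" and "infinite M"
    and "closure (convex hull A) = UNIV"
  shows "seq_topology A closure_of Theta A M = topspace (seq_topology A)
    \<and> gdelta_in (seq_topology A) (Theta A M)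
    \<and> (subspace A \<longrightarrow> contains_subspace_except_0 (Theta A M))"
proof (intro conjI impI)
  note lc = assms(1)
  obtain D :: "'v set" where D: "countable D" "closure D = UNIV"
    using assms(2) unfolding separable_space_def by (auto simp: euclidean_closure_of)
  then have D_dense: "\<exists>d\<in>D. dist d x < e" if "0 < e" for x e
    using that closure_approachable[of x D] by auto
  have ext: "\<exists>\<phi>\<in>Theta A M. \<forall>j<N. \<phi> j = \<theta> j" if "\<theta> \<in> UNIV \<rightarrow> A" for \<theta> N
    using Theta_extension[OF lc assms(4,5) D(1) D_dense that] .
  show "seq_topology A closure_of Theta A M = topspace (seq_topology A)"
    using ext by (intro dense_in_seq_topology) (auto simp: Theta_def)
  have "Theta A M = {\<theta> \<in> UNIV \<rightarrow> A. \<forall>xs\<in>lists D. near_targets M xs \<theta>}"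
    by (rule Theta_eq) (rule D_dense)
  \<comment> \<open>The empty list makes the family nonempty, so the intersection retains membership
    in \<open>UNIV \<rightarrow> A\<close>.\<close>
  also have "\<dots> = (\<Inter>xs\<in>lists D. {\<theta> \<in> UNIV \<rightarrow> A. near_targets M xs \<theta>})"
    using lists.Nil[of D] by blast
  finally show "gdelta_in (seq_topology A) (Theta A M)"
  proof (simp only:, intro gdelta_in_Inter)
    show "countable ((\<lambda>xs. {\<theta> \<in> UNIV \<rightarrow> A. near_targets M xs \<theta>}) ` lists D)"
      by (intro countable_image countable_lists D)
  qed (auto intro: open_imp_gdelta_in openin_near_targets[OF lc])
  assume A: "subspace A"
  \<comment> \<open>The zero sequence only shows that the product is nonempty, so that density
    provides an element of Theta.\<close>
  then have "(\<lambda>_. 0) \<in> UNIV \<rightarrow> A"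
    by (simp add: subspace_0)
  from ext[OF this, of 0] obtain \<theta> where \<theta>: "\<theta> \<in> Theta A M"
    by blast
  interpret vector_space "seq_scale :: real \<Rightarrow> (nat \<Rightarrow> 'v) \<Rightarrow> nat \<Rightarrow> 'v"
    by (rule vector_space_seq_scale)
  show "contains_subspace_except_0 (Theta A M)"
    unfolding contains_subspace_except_0_def
  proof (intro exI conjI impI)
    show "subspace (span {\<theta>})"
      by (rule subspace_span)
    show "span {\<theta>} - {0} \<subseteq> Theta A M"
      using Theta_seq_scale[OF lc A \<theta>] by (auto simp: span_singleton) (metis scale_zero_left)
    show "span {\<theta>} \<noteq> {0}" if "(UNIV :: 'v set) \<noteq> {0}"
      using Theta_nonzero[OF \<theta> that] span_base[of \<theta> "{\<theta>}"] by auto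
  qed
qed

end
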